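(* Let $\mathbf{M}=(\mathbf{A},\mathbf{P},\mathbf{L})$ be a minimum (primitive) unit cell description of a crystal and let $\mathcal{X}$ be its Mat2Seq sequence, as defined in the context. Then the crystal structure $(\mathbf{A},\mathbf{P},\mathbf{L})$ can be fully recovered from $\mathcal{X}$. That is, $\mathcal{X}$ determines a unit cell description $(\tilde{\mathbf{A}},\tilde{\mathbf{P}},\tilde{\mathbf{L}})$ whose infinite crystal structure coincides with that of $(\mathbf{A},\mathbf{P},\mathbf{L})$ up to a rotation $\mathbf{R}$ with $\det\mathbf{R}=1$ and a translation $\mathbf{b}\in\mathbb{R}^3$.
   Context: Crystal descriptions. A crystal is described by $\mathbf{M}=(\mathbf{A},\mathbf{P},\mathbf{L})$. Here $\mathbf{A}=[\boldsymbol{a}_1,\dots,\boldsymbol{a}_n]$ lists the atom features of the $n$ atoms in a unit cell (for Mat2Seq, the feature of atom $i$ is its type, i.e. its atomic number $Z_i$). $\mathbf{P}=[\boldsymbol{p}_1,\dots,\boldsymbol{p}_n]\in\mathbb{R}^{3\times n}$ lists their positions. $\mathbf{L}=[\boldsymbol{\ell}_1,\boldsymbol{\ell}_2,\boldsymbol{\ell}_3]\in\mathbb{R}^{3\times3}$ has three linearly independent lattice vectors as columns. The infinite crystal structure represented by $\mathbf{M}$ is the set of all positions $\boldsymbol{p}_i+k_1\boldsymbol{\ell}_1+k_2\boldsymbol{\ell}_2+k_3\boldsymbol{\ell}_3$ ($1\le i\le n$, $k_1,k_2,k_3\in\mathbb{Z}$), each carrying the feature $\boldsymbol{a}_i$.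 A description is a minimum (primitive) unit cell if its cell has the smallest possible volume among all descriptions of the same infinite structure. Fractional coordinates. With respect to a lattice basis $\boldsymbol{\ell}_1',\boldsymbol{\ell}_2',\boldsymbol{\ell}_3'$, the fractional coordinates $(x_j,y_j,z_j)$ of an atom at $\boldsymbol{p}_j$ are defined by $\boldsymbol{p}_j=x_j\boldsymbol{\ell}_1'+y_j\boldsymbol{\ell}_2'+z_j\boldsymbol{\ell}_3'$. Construction of Mat2Seq. Step 1 (lattice). From the lattice generated by $\mathbf{L}$, choose by Niggli reduction a basis $\mathbf{L}_u=[\boldsymbol{\ell}_1',\boldsymbol{\ell}_2',\boldsymbol{\ell}_3']$ of the same lattice. It consists of three shortest non-coplanar lattice vectors forming a right-handed system, and the choice is made using only the three vector lengths and the three angles between the vectors. Step 2 (origin). Fix a radius $r>0$. For an atom $i$, let $\mathcal{N}(i,r)$ be the atoms of the infinite crystal within distance $r$ of atom $i$. Let $\mathcal{N}^{\boldsymbol{\ell}_1'}(i,r)$, $\mathcal{N}^{\boldsymbol{\ell}_2'}(i,r)$, $\mathcal{N}^{\boldsymbol{\ell}_3'}(i,r)$ be the subsets of those $j\in\mathcal{N}(i,r)$ with $x_j>x_i$, respectively $y_j>y_i$, respectively $z_j>z_i$ (fractional coordinates with respect to $\mathbf{L}_u$). Put $\rho_{i,r}=\sum_{j\in\mathcal{N}(i,r)}Z_j$ and $\rho_{i,r}^{\boldsymbol{\ell}_k'}=\sum_{j\in\mathcal{N}^{\boldsymbol{\ell}_k'}(i,r)}Z_j$ for $k=1,2,3$.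 An origin atom $i$ is selected by a fixed rule which successively compares: first, smallest atomic number; second, the local density $\rho_{i,r}$; third, the densities $\rho_{i,r}^{\boldsymbol{\ell}_1'},\rho_{i,r}^{\boldsymbol{\ell}_2'},\rho_{i,r}^{\boldsymbol{\ell}_3'}$. The origin is moved to atom $i$ by replacing the fractional coordinates of every atom $j$ by $\big((x_j-x_i)\bmod 1,\ (y_j-y_i)\bmod 1,\ (z_j-z_i)\bmod 1\big)$. The resulting matrix of fractional coordinates is $\mathbf{P}_{\mathrm{frac},u}$, $\mathbf{P}_u=\mathbf{L}_u\mathbf{P}_{\mathrm{frac},u}$, and $\mathbf{A}_u$ is the corresponding list of atom types. Step 3 (sequence). The sequence $\mathcal{X}$ of $\mathbf{M}$ records the following: (i) the composition (atom types and numbers of atoms in the cell); (ii) the space group information of the crystal, with its symmetry transformations $(\mathbf{R}_1,\mathbf{b}_1),\dots,(\mathbf{R}_s,\mathbf{b}_s)$ (all space group operations modulo lattice translations), acting on fractional coordinates with respect to the cell $(\mathbf{A}_u,\mathbf{P}_u,\mathbf{L}_u)$ by $\boldsymbol{q}\mapsto(\mathbf{R}_i\boldsymbol{q}+\mathbf{b}_i)\bmod 1$; (iii) the lattice lengths $a=\|\boldsymbol{\ell}_1'\|_2$, $b=\|\boldsymbol{\ell}_2'\|_2$, $c=\|\boldsymbol{\ell}_3'\|_2$ and the three angles $\alpha,\beta,\gamma$ between the vectors $\boldsymbol{\ell}_1',\boldsymbol{\ell}_2',\boldsymbol{\ell}_3'$; (iv) for each atom of an irreducible atom set, its type and fractional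 coordinates $[Z_i,x_i,y_i,z_i]$. An irreducible atom set contains one representative of each orbit of the atoms of the cell under the symmetry transformations. The irreducible atoms are listed in an order determined by atomic number, number of atoms recoverable from each of them by symmetry, and fractional coordinates. Entries are real numbers here (no rounding). *)

theory Defs
  imports "HOL-Analysis.Analysis" "HOL-Library.Multiset"
begin

section \<open>Crystal descriptions\<close>

text \<open>The atom feature is the atomic number. The columns of the matrix are the lattice vectors,
  so \<open>L *v k\<close> is the combination of the lattice vectors with coefficients \<open>k\<close>.\<close>

datatype crystal =
  Crystal (types: "nat list") (positions: "(real^3) list") (lattice: "real^3^3")

definition num_atoms :: "crystal \<Rightarrow> nat" where
  "num_atoms M = length (types M)"

definition int_vectors :: "(real^3) set" where
  "int_vectors = {k. \<forall>i. k $ i \<in> \<int>}"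

definition lattice_points :: "real^3^3 \<Rightarrow> (real^3) set" where
  "lattice_points L = (\<lambda>k. L *v k) ` int_vectors"

text \<open>The last conjunct says that the \<open>n\<close> listed atoms are \<open>n\<close> different atoms of the crystal, so
  that every position of the infinite structure carries one feature.\<close>

definition unit_cell :: "crystal \<Rightarrow> bool" where
  "unit_cell M \<longleftrightarrow>
     length (positions M) = length (types M) \<and>
     invertible (lattice M) \<and>
     (\<forall>i<num_atoms M. \<forall>j<num_atoms M. i \<noteq> j \<longrightarrow>
        positions M ! i - positions M ! j \<notin> lattice_points (lattice M))"

definition infinite_structure :: "crystal \<Rightarrow> ((real^3) \<times> nat) set" where
  "infinite_structure M =
     {(positions M ! i + v, types M ! i) | i v.
        i < num_atoms M \<and> v \<in> lattice_points (lattice M)}"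

definition cell_volume :: "crystal \<Rightarrow> real" where
  "cell_volume M = \<bar>det (lattice M)\<bar>"

definition primitive_cell :: "crystal \<Rightarrow> bool" where
  "primitive_cell M \<longleftrightarrow>
     unit_cell M \<and>
     (\<forall>M'. unit_cell M' \<and> infinite_structure M' = infinite_structure M \<longrightarrow>
        cell_volume M \<le> cell_volume M')"

definition move :: "real^3^3 \<Rightarrow> real^3 \<Rightarrow> (real^3) \<times> nat \<Rightarrow> (real^3) \<times> nat" where
  "move Q t = (\<lambda>(p, z). (Q *v p + t, z))"

definition frac_coords :: "real^3^3 \<Rightarrow> real^3 \<Rightarrow> real^3" where
  "frac_coords L p = (THE q. p = q $ 1 *\<^sub>R column 1 L + q $ 2 *\<^sub>R column 2 L + q $ 3 *\<^sub>R column 3 L)"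

definition mod1 :: "real^3 \<Rightarrow> real^3" where
  "mod1 q = (\<chi> k. frac (q $ k))"

section \<open>Step 1: the lattice\<close>

definition vec_angle :: "real^3 \<Rightarrow> real^3 \<Rightarrow> real" where
  "vec_angle u v = arccos ((u \<bullet> v) / (norm u * norm v))"

text \<open>Niggli's conditions as in the International Tables for Crystallography, for the squared lengths
  \<open>A = a \<bullet> a\<close>, \<open>B = b \<bullet> b\<close>, \<open>C = c \<bullet> c\<close> and the products
  \<open>\<xi> = b \<bullet> c\<close>, \<open>\<eta> = a \<bullet> c\<close>, \<open>\<zeta> = a \<bullet> b\<close> (without the customary factor 2). The first disjunct
  describes cells of type I (all angles acute), the second one cells of type II (no angle acute).\<close>

definition niggli_conditions ::
    "real \<Rightarrow> real \<Rightarrow> real \<Rightarrow> real \<Rightarrow> real \<Rightarrow> real \<Rightarrow> bool" where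
  "niggli_conditions A B C \<xi> \<eta> \<zeta> \<longleftrightarrow>
     A \<le> B \<and> B \<le> C \<and> \<bar>\<xi>\<bar> \<le> B / 2 \<and> \<bar>\<eta>\<bar> \<le> A / 2 \<and> \<bar>\<zeta>\<bar> \<le> A / 2 \<and>
     (A = B \<longrightarrow> \<bar>\<xi>\<bar> \<le> \<bar>\<eta>\<bar>) \<and> (B = C \<longrightarrow> \<bar>\<eta>\<bar> \<le> \<bar>\<zeta>\<bar>) \<and>
     ((0 < \<xi> \<and> 0 < \<eta> \<and> 0 < \<zeta> \<and>
       (\<xi> = B / 2 \<longrightarrow> \<zeta> \<le> 2 * \<eta>) \<and>
       (\<eta> = A / 2 \<longrightarrow> \<zeta> \<le> 2 * \<xi>) \<and>
       (\<zeta> = A / 2 \<longrightarrow> \<eta> \<le> 2 * \<xi>)) \<or>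
      (\<xi> \<le> 0 \<and> \<eta> \<le> 0 \<and> \<zeta> \<le> 0 \<and>
       \<bar>\<xi>\<bar> + \<bar>\<eta>\<bar> + \<bar>\<zeta>\<bar> \<le> (A + B) / 2 \<and>
       (\<bar>\<xi>\<bar> = B / 2 \<longrightarrow> \<zeta> = 0) \<and>
       (\<bar>\<eta>\<bar> = A / 2 \<longrightarrow> \<zeta> = 0) \<and>
       (\<bar>\<zeta>\<bar> = A / 2 \<longrightarrow> \<eta> = 0) \<and>
       (\<bar>\<xi>\<bar> + \<bar>\<eta>\<bar> + \<bar>\<zeta>\<bar> = (A + B) / 2 \<longrightarrow> A \<le> 2 * \<bar>\<eta>\<bar> + \<bar>\<zeta>\<bar>)))"

text \<open>The quantified matrix \<open>V\<close> ranges over all triples of non-coplanar lattice vectors, whether or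
  not they form a basis of the lattice.\<close>

definition niggli_basis :: "real^3^3 \<Rightarrow> real^3^3 \<Rightarrow> bool" where
  "niggli_basis L Lu \<longleftrightarrow>
     lattice_points Lu = lattice_points L \<and>
     det Lu > 0 \<and>
     (\<forall>V :: real^3^3. invertible V \<and> (\<forall>k. column k V \<in> lattice_points L) \<longrightarrow>
        (\<Sum>k\<in>UNIV. norm (column k Lu)) \<le> (\<Sum>k\<in>UNIV. norm (column k V))) \<and>
     niggli_conditions
       (column 1 Lu \<bullet> column 1 Lu) (column 2 Lu \<bullet> column 2 Lu) (column 3 Lu \<bullet> column 3 Lu)
       (column 2 Lu \<bullet> column 3 Lu) (column 1 Lu \<bullet> column 3 Lu) (column 1 Lu \<bullet> column 2 Lu)"

section \<open>Step 2: the origin\<close>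

definition neighbours :: "real \<Rightarrow> crystal \<Rightarrow> nat \<Rightarrow> ((real^3) \<times> nat) set" where
  "neighbours r M i = {(p, z) \<in> infinite_structure M. dist p (positions M ! i) \<le> r}"

definition neighbours_along ::
    "real \<Rightarrow> real^3^3 \<Rightarrow> crystal \<Rightarrow> nat \<Rightarrow> 3 \<Rightarrow> ((real^3) \<times> nat) set" where
  "neighbours_along r Lu M i k =
     {(p, z) \<in> neighbours r M i. frac_coords Lu p $ k > frac_coords Lu (positions M ! i) $ k}"

definition local_density :: "real \<Rightarrow> crystal \<Rightarrow> nat \<Rightarrow> nat" where
  "local_density r M i = (\<Sum>(p, z)\<in>neighbours r M i. z)"

definition local_density_along :: "real \<Rightarrow> real^3^3 \<Rightarrow> crystal \<Rightarrow> nat \<Rightarrow> 3 \<Rightarrow> nat" where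
  "local_density_along r Lu M i k = (\<Sum>(p, z)\<in>neighbours_along r Lu M i k. z)"

text \<open>An origin atom has a lexicographically least key; atoms with equal least keys are all
  admissible. The sign \<open>\<sigma> m \<in> {1, -1}\<close> fixes whether the smaller or the larger value is preferred
  in the \<open>m\<close>-th density comparison.\<close>

definition origin_key ::
    "real \<Rightarrow> (nat \<Rightarrow> int) \<Rightarrow> real^3^3 \<Rightarrow> crystal \<Rightarrow> nat \<Rightarrow> int list" where
  "origin_key r \<sigma> Lu M i =
     [int (types M ! i),
      \<sigma> 0 * int (local_density r M i),
      \<sigma> 1 * int (local_density_along r Lu M i 1),
      \<sigma> 2 * int (local_density_along r Lu M i 2),
      \<sigma> 3 * int (local_density_along r Lu M i 3)]"

definition origin_atom ::
    "real \<Rightarrow> (nat \<Rightarrow> int) \<Rightarrow> real^3^3 \<Rightarrow> crystal \<Rightarrow> nat \<Rightarrow> bool" where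
  "origin_atom r \<sigma> Lu M i \<longleftrightarrow>
     i < num_atoms M \<and>
     (\<forall>j<num_atoms M. ord_class.lexordp_eq (origin_key r \<sigma> Lu M i) (origin_key r \<sigma> Lu M j))"

definition shifted_cell :: "real^3^3 \<Rightarrow> crystal \<Rightarrow> nat \<Rightarrow> crystal" where
  "shifted_cell Lu M i =
     Crystal (types M)
       (map (\<lambda>p. Lu *v mod1 (frac_coords Lu p - frac_coords Lu (positions M ! i))) (positions M))
       Lu"

section \<open>Step 3: the sequence\<close>

definition space_group :: "((real^3) \<times> nat) set \<Rightarrow> ((real^3^3) \<times> (real^3)) set" where
  "space_group S = {(Q, t). orthogonal_matrix Q \<and> move Q t ` S = S}"

text \<open>The space group operations rewritten in fractional coordinates; each class modulo lattice
  translations is represented by the operation whose translation part lies in \<open>[0, 1)\<^sup>3\<close>.\<close>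

definition symmetry_transformations :: "crystal \<Rightarrow> ((real^3^3) \<times> (real^3)) set" where
  "symmetry_transformations U =
     {(R, mod1 b) | R b. \<exists>(Q, t) \<in> space_group (infinite_structure U).
        \<forall>q. lattice U *v (R *v q + b) = Q *v (lattice U *v q) + t}"

definition cell_coords :: "crystal \<Rightarrow> nat \<Rightarrow> real^3" where
  "cell_coords U j = frac_coords (lattice U) (positions U ! j)"

definition orbit :: "crystal \<Rightarrow> nat \<Rightarrow> nat set" where
  "orbit U i =
     {j. j < num_atoms U \<and> types U ! j = types U ! i \<and>
         (\<exists>(R, b) \<in> symmetry_transformations U. cell_coords U j = mod1 (R *v cell_coords U i + b))}"

definition irreducible_atom_set :: "crystal \<Rightarrow> nat set \<Rightarrow> bool" where
  "irreducible_atom_set U I \<longleftrightarrow>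
     I \<subseteq> {..<num_atoms U} \<and> (\<forall>i<num_atoms U. \<exists>!j. j \<in> I \<and> j \<in> orbit U i)"

type_synonym atom_key = "nat \<times> nat \<times> real \<times> real \<times> real"

definition irreducible_key :: "crystal \<Rightarrow> nat \<Rightarrow> atom_key" where
  "irreducible_key U j =
     (types U ! j, card (orbit U j), cell_coords U j $ 1, cell_coords U j $ 2, cell_coords U j $ 3)"

definition irreducible_listing :: "atom_key rel \<Rightarrow> crystal \<Rightarrow> nat list \<Rightarrow> bool" where
  "irreducible_listing ord U js \<longleftrightarrow>
     distinct js \<and> irreducible_atom_set U (set js) \<and>
     sorted_wrt (\<lambda>i j. (irreducible_key U i, irreducible_key U j) \<in> ord) js"

datatype mat2seq = Mat2Seq
  (composition: "nat multiset")
  (symmetries: "((real^3^3) \<times> (real^3)) list")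
  (lengths: "real \<times> real \<times> real")
  (angles: "real \<times> real \<times> real")
  (irreducible_atoms: "(nat \<times> real \<times> real \<times> real) list")

text \<open>\<open>X\<close> is a sequence of \<open>M\<close> if it results from some admissible outcome of the choices left open by
  the construction: the basis, the origin atom among those with the least key, the representatives
  of the orbits, and the order in which the symmetry transformations are written down.\<close>

definition is_mat2seq ::
    "real \<Rightarrow> (nat \<Rightarrow> int) \<Rightarrow> atom_key rel \<Rightarrow> crystal \<Rightarrow> mat2seq \<Rightarrow> bool" where
  "is_mat2seq r \<sigma> ord M X \<longleftrightarrow>
     (\<exists>Lu i U js.
        niggli_basis (lattice M) Lu \<and>
        origin_atom r \<sigma> Lu M i \<and>
        U = shifted_cell Lu M i \<and>
        irreducible_listing ord U js \<and>
        composition X = mset (types U) \<and>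
        distinct (symmetries X) \<and> set (symmetries X) = symmetry_transformations U \<and>
        lengths X = (norm (column 1 Lu), norm (column 2 Lu), norm (column 3 Lu)) \<and>
        angles X = (vec_angle (column 2 Lu) (column 3 Lu),
                    vec_angle (column 1 Lu) (column 3 Lu),
                    vec_angle (column 1 Lu) (column 2 Lu)) \<and>
        irreducible_atoms X =
          map (\<lambda>j. (types U ! j, cell_coords U j $ 1, cell_coords U j $ 2, cell_coords U j $ 3)) js)"

end

theory Submission
  imports Defs
begin

text \<open>The lattice lengths and angles determine the Gram matrix of the reduced basis, hence the basis
  up to a rotation. In coordinates with respect to that basis, the symmetry transformations applied
  to the irreducible atoms give all atoms modulo lattice translations. So two crystals with a common
  sequence differ by a rotation and a translation, and the recovery map may return any primitive
  description that has the given sequence.\<close>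

section \<open>Integer vectors, lattice points and fractional coordinates\<close>

lemma int_vectors_0 [simp]: "0 \<in> int_vectors"
  by (simp add: int_vectors_def)

lemma int_vectors_add: "k \<in> int_vectors \<Longrightarrow> l \<in> int_vectors \<Longrightarrow> k + l \<in> int_vectors"
  by (simp add: int_vectors_def)

lemma int_vectors_minus: "k \<in> int_vectors \<Longrightarrow> - k \<in> int_vectors"
  by (simp add: int_vectors_def)

lemma lattice_points_0 [simp]: "0 \<in> lattice_points L"
  unfolding lattice_points_def by (rule image_eqI[of _ _ 0]) auto

lemma lattice_points_add:
  assumes "v \<in> lattice_points L" "w \<in> lattice_points L"
  shows "v + w \<in> lattice_points L"
proof -
  obtain k l where "v = L *v k" "w = L *v l" "k \<in> int_vectors" "l \<in> int_vectors"
    using assms by (auto simp: lattice_points_def)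
  then show ?thesis
    unfolding lattice_points_def
    by (intro image_eqI[of _ _ "k + l"]) (auto simp: int_vectors_add matrix_vector_right_distrib)
qed

lemma matrix_vector_mult_minus: "A *v (- x) = - (A *v x)" for A :: "real^'n^'m"
  using matrix_vector_mult_diff_distrib[of A 0 x] by simp

lemma lattice_points_minus:
  assumes "v \<in> lattice_points L"
  shows "- v \<in> lattice_points L"
proof -
  obtain k where "v = L *v k" "k \<in> int_vectors"
    using assms by (auto simp: lattice_points_def)
  then show ?thesis
    unfolding lattice_points_def
    by (intro image_eqI[of _ _ "- k"]) (auto simp: int_vectors_minus matrix_vector_mult_minus)
qed

text \<open>Every reduction modulo 1 is handled through this form: the integer vector
  \<open>k\<close> becomes a lattice vector once a basis is applied.\<close>

lemma mod1_cases:
  obtains k where "k \<in> int_vectors" "mod1 q = q + k"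
proof (rule that)
  show "(\<chi> i. - of_int \<lfloor>q $ i\<rfloor>) \<in> int_vectors"
    by (simp add: int_vectors_def)
  show "mod1 q = q + (\<chi> i. - of_int \<lfloor>q $ i\<rfloor>)"
    by (simp add: mod1_def frac_def vec_eq_iff)
qed

lemma
  fixes A :: "real^'n^'m"
  assumes "invertible A"
  shows matrix_inv_right: "A ** matrix_inv A = mat 1"
    and matrix_inv_left: "matrix_inv A ** A = mat 1"
  using someI_ex[OF assms[unfolded invertible_def]] by (simp_all add: matrix_inv_def)

text \<open>The definite description in \<open>frac_coords\<close> denotes because an invertible
  \<open>L\<close> is injective.\<close>

lemma frac_coords_matrix_vector:
  assumes "invertible L"
  shows "frac_coords L (L *v q) = q"
proof -
  have L: "q $ 1 *\<^sub>R column 1 L + q $ 2 *\<^sub>R column 2 L + q $ 3 *\<^sub>R column 3 L = L *v q" for q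
    by (simp add: matrix_mult_sum sum_3 scalar_mult_eq_scaleR)
  have "inj ((*v) L)"
    using assms by (simp add: inj_matrix_vector_mult)
  then show ?thesis
    unfolding frac_coords_def L by (auto dest: injD)
qed

lemma matrix_vector_frac_coords:
  assumes "invertible L"
  shows "L *v frac_coords L p = p"
proof -
  have "p = L *v (matrix_inv L *v p)"
    using assms by (simp add: matrix_vector_mul_assoc matrix_inv_right)
  then show ?thesis
    using frac_coords_matrix_vector[OF assms] by metis
qed

section \<open>Motions and changes of the cell\<close>

lemma move_move: "move Q t (move R b x) = move (Q ** R) (Q *v b + t) x"
  by (cases x) (simp add: move_def matrix_vector_mul_assoc matrix_vector_right_distrib algebra_simps)

lemma move_id [simp]: "move (mat 1) 0 x = x"
  by (cases x) (simp add: move_def)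

lemma infinite_structure_lattice_translate:
  assumes "(p, z) \<in> infinite_structure M" "v \<in> lattice_points (lattice M)"
  shows "(p + v, z) \<in> infinite_structure M"
proof -
  obtain i w where "i < num_atoms M" "w \<in> lattice_points (lattice M)"
    "p = positions M ! i + w" "z = types M ! i"
    using assms(1) by (auto simp: infinite_structure_def)
  then show ?thesis
    using assms(2) unfolding infinite_structure_def
    by (auto intro!: exI[of _ i] exI[of _ "w + v"] lattice_points_add simp: add.assoc)
qed

text \<open>A lattice vector added to a position only permutes the translates of that atom.
  Comparing lattices instead of matrices lets this cover a change of basis.\<close>

lemma infinite_structure_congruent_positions:
  assumes "types M = types N" and "lattice_points (lattice M) = lattice_points (lattice N)"
    and "\<And>i. i < num_atoms N \<Longrightarrow> positions M ! i - (positions N ! i + t) \<in> lattice_points (lattice N)"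
  shows "infinite_structure M = move (mat 1) t ` infinite_structure N"
proof (intro set_eqI iffI)
  fix x assume "x \<in> infinite_structure M"
  then obtain i v where i: "i < num_atoms N" "v \<in> lattice_points (lattice N)"
    "x = (positions M ! i + v, types N ! i)"
    using assms(1,2) by (auto simp: infinite_structure_def num_atoms_def)
  define w where "w = v + (positions M ! i - (positions N ! i + t))"
  have "w \<in> lattice_points (lattice N)"
    unfolding w_def using i assms(3) by (intro lattice_points_add) auto
  moreover have "x = move (mat 1) t (positions N ! i + w, types N ! i)"
    using i by (simp add: move_def w_def)
  ultimately show "x \<in> move (mat 1) t ` infinite_structure N"
    using i unfolding infinite_structure_def by blast
next
  fix x assume "x \<in> move (mat 1) t ` infinite_structure N"
  then obtain i v where i: "i < num_atoms N" "v \<in> lattice_points (lattice N)"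
    "x = (positions N ! i + v + t, types N ! i)"
    by (auto simp: infinite_structure_def move_def)
  define w where "w = v + - (positions M ! i - (positions N ! i + t))"
  have "w \<in> lattice_points (lattice M)"
    unfolding w_def assms(2) using i assms(3)
    by (intro lattice_points_add lattice_points_minus) auto
  moreover have "x = (positions M ! i + w, types M ! i)"
    using i assms(1) by (simp add: w_def)
  moreover have "i < num_atoms M"
    using i assms(1) by (simp add: num_atoms_def)
  ultimately show "x \<in> infinite_structure M"
    unfolding infinite_structure_def by blast
qed

text \<open>Taking coordinates relative to atom \<open>i\<close> is a translation; reducing them
  modulo 1 then moves each atom by a lattice vector, which the infinite structure does not
  see.\<close>

lemma infinite_structure_shifted_cell:
  assumes "unit_cell M" "invertible Lu" "lattice_points Lu = lattice_points (lattice M)"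
  shows "infinite_structure (shifted_cell Lu M i)
    = move (mat 1) (- (positions M ! i)) ` infinite_structure M"
proof (rule infinite_structure_congruent_positions)
  fix j assume j: "j < num_atoms M"
  let ?p = "\<lambda>j. positions M ! j"
  let ?d = "frac_coords Lu (?p j) - frac_coords Lu (?p i)"
  obtain k where k: "k \<in> int_vectors" "mod1 ?d = ?d + k"
    by (rule mod1_cases)
  have "positions (shifted_cell Lu M i) ! j = Lu *v mod1 ?d"
    using j assms(1) by (simp add: shifted_cell_def num_atoms_def unit_cell_def)
  also have "\<dots> = ?p j + - ?p i + Lu *v k"
    by (simp add: k matrix_vector_right_distrib matrix_vector_mult_diff_distrib
        matrix_vector_frac_coords assms(2))
  finally show "positions (shifted_cell Lu M i) ! j - (?p j + - ?p i) \<in> lattice_points (lattice M)"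
    using k by (simp flip: assms(3)) (simp add: lattice_points_def)
qed (use assms in \<open>simp_all add: shifted_cell_def\<close>)

section \<open>Symmetry transformations and orbits of atoms\<close>

text \<open>Since \<open>b\<close> is a translation part reduced modulo 1, the map is a space group
  operation followed by a lattice translation, and both preserve the structure.\<close>

lemma symmetry_transformation_mem:
  assumes "(R, b) \<in> symmetry_transformations U" "(lattice U *v q, z) \<in> infinite_structure U"
  shows "(lattice U *v (R *v q + b), z) \<in> infinite_structure U"
proof -
  let ?S = "infinite_structure U" and ?L = "lattice U"
  obtain b0 Q t where b: "b = mod1 b0" and Q: "move Q t ` ?S = ?S"
    and eq: "\<And>q. ?L *v (R *v q + b0) = Q *v (?L *v q) + t"
    using assms(1) by (auto simp: symmetry_transformations_def space_group_def)
  obtain k where k: "k \<in> int_vectors" "mod1 b0 = b0 + k"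
    by (rule mod1_cases)
  have "move Q t (?L *v q, z) \<in> ?S"
    using Q assms(2) by blast
  then have "(?L *v (R *v q + b0) + ?L *v k, z) \<in> ?S"
    using k by (intro infinite_structure_lattice_translate) (auto simp: eq move_def lattice_points_def)
  then show ?thesis
    by (simp add: b k matrix_vector_right_distrib add.assoc)
qed

text \<open>The integer vector is absorbed into the symmetry before inverting it, so that the inverse
  matrix need not be known to be integral.\<close>

lemma orbit_inverse:
  assumes "invertible (lattice U)" "j \<in> orbit U i"
  obtains R b k where "(R, b) \<in> symmetry_transformations U" "k \<in> int_vectors"
    "cell_coords U i = R *v cell_coords U j + b + k"
proof -
  let ?S = "infinite_structure U" and ?L = "lattice U"
  let ?ci = "cell_coords U i" and ?cj = "cell_coords U j"
  obtain R b0 Q t where cj: "?cj = mod1 (R *v ?ci + mod1 b0)" and orth: "orthogonal_matrix Q"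
    and Q: "move Q t ` ?S = ?S" and eq: "\<And>q. ?L *v (R *v q + b0) = Q *v (?L *v q) + t"
    using assms(2) by (auto simp: orbit_def symmetry_transformations_def space_group_def)
  obtain k1 where k1: "k1 \<in> int_vectors" "mod1 b0 = b0 + k1"
    by (rule mod1_cases)
  obtain k2 where k2: "k2 \<in> int_vectors" "?cj = R *v ?ci + mod1 b0 + k2"
    unfolding cj by (rule mod1_cases)
  \<comment> \<open>Both reductions modulo 1, of the translation part and of the image point, are
    collected in \<open>v\<close>: with translation \<open>t + v\<close> the operation takes the
    listed position of atom \<open>i\<close> exactly to that of atom \<open>j\<close>.\<close>
  define v where "v = ?L *v (k1 + k2)"
  have v: "v \<in> lattice_points ?L"
    using k1 k2 by (simp add: v_def lattice_points_def int_vectors_add)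
  \<comment> \<open>The pair \<open>(Q', t')\<close> is the inverse of the motion with matrix
    \<open>Q\<close> and translation \<open>t + v\<close>.\<close>
  define Q' where "Q' = transpose Q"
  define t' where "t' = - (Q' *v (t + v))"
  have Q'Q: "Q' ** Q = mat 1"
    using orth by (simp add: Q'_def orthogonal_matrix)
  have "move (mat 1) v ` ?S = ?S"
  proof (intro set_eqI iffI)
    fix x assume "x \<in> ?S"
    then have "(fst x + - v, snd x) \<in> ?S"
      using v by (intro infinite_structure_lattice_translate lattice_points_minus) auto
    moreover have "x = move (mat 1) v (fst x + - v, snd x)"
      by (simp add: move_def)
    ultimately show "x \<in> move (mat 1) v ` ?S"
      by blast
  next
    fix x assume "x \<in> move (mat 1) v ` ?S"
    then show "x \<in> ?S"
      using v by (auto simp: move_def intro: infinite_structure_lattice_translate)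
  qed
  \<comment> \<open>Writing the structure as its own image under \<open>Q\<close>, \<open>t\<close>
    and then under \<open>v\<close> makes the three motions cancel.\<close>
  then have "move Q' t' ` ?S = move Q' t' ` move (mat 1) v ` move Q t ` ?S"
    using Q by simp
  also have "\<dots> = ?S"
    by (simp add: image_image move_move Q'Q t'_def matrix_vector_right_distrib add.commute)
  finally have sg: "(Q', t') \<in> space_group ?S"
    using orth by (simp add: space_group_def Q'_def)
  \<comment> \<open>Conjugation by the basis passes from Cartesian to fractional
    coordinates.\<close>
  define R' where "R' = matrix_inv ?L ** Q' ** ?L"
  define b' where "b' = matrix_inv ?L *v t'"
  have eq': "?L *v (R' *v q + b') = Q' *v (?L *v q) + t'" for q
    using matrix_inv_right[OF assms(1)]
    by (simp add: R'_def b'_def matrix_vector_right_distrib matrix_vector_mul_assoc matrix_mul_assoc)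
  have sym: "(R', mod1 b') \<in> symmetry_transformations U"
    using sg eq' unfolding symmetry_transformations_def by blast
  have "?L *v ?cj = Q *v (?L *v ?ci) + (t + v)"
    using eq[of ?ci] by (simp add: k2 k1 v_def matrix_vector_right_distrib algebra_simps)
  then have "?L *v (R' *v ?cj + b') = Q' *v (Q *v (?L *v ?ci) + (t + v)) + t'"
    by (simp only: eq')
  also have "\<dots> = (Q' ** Q) *v (?L *v ?ci)"
    by (simp add: t'_def matrix_vector_right_distrib del: matrix_vector_mul_assoc)
       (simp add: matrix_vector_mul_assoc matrix_mul_assoc)
  finally have "?L *v (R' *v ?cj + b') = ?L *v ?ci"
    by (simp only: Q'Q matrix_vector_mul_lid)
  then have ci: "?ci = R' *v ?cj + b'"
    using inj_matrix_vector_mult[OF assms(1)] by (metis injD)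
  obtain k where k: "k \<in> int_vectors" "mod1 b' = b' + k"
    by (rule mod1_cases)
  \<comment> \<open>The stored translation part is \<open>mod1 b'\<close>, so the integer vector to
    supply is \<open>- k\<close>.\<close>
  show thesis
    using sym int_vectors_minus[OF k(1)] by (rule that) (simp add: ci k)
qed

text \<open>That \<open>j\<close> lies in the orbit of \<open>i\<close> means that a symmetry
  carries \<open>i\<close> to \<open>j\<close>; \<open>orbit_inverse\<close> reverses this and
  recovers \<open>i\<close> from its representative \<open>j\<close> up to an integer vector.
  Conversely, symmetries and lattice translations lead from atoms to atoms of the same type.\<close>

lemma infinite_structure_from_irreducible:
  assumes inv: "invertible (lattice U)" and irr: "irreducible_atom_set U I"
  shows "infinite_structure U =
    {(lattice U *v (R *v cell_coords U j + b + k), types U ! j) | R b k j.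
       (R, b) \<in> symmetry_transformations U \<and> k \<in> int_vectors \<and> j \<in> I}" (is "?S = ?T")
proof -
  let ?L = "lattice U"
  have L: "?L *v cell_coords U j = positions U ! j" for j
    by (simp add: cell_coords_def matrix_vector_frac_coords inv)
  show ?thesis
  proof (intro set_eqI iffI)
    fix x assume "x \<in> ?S"
    then obtain i l where i: "i < num_atoms U" "l \<in> int_vectors"
      "x = (positions U ! i + ?L *v l, types U ! i)"
      by (auto simp: infinite_structure_def lattice_points_def)
    obtain j where j: "j \<in> I" "j \<in> orbit U i"
      using irr i(1) unfolding irreducible_atom_set_def by blast
    obtain R b k where R: "(R, b) \<in> symmetry_transformations U" "k \<in> int_vectors"
      "cell_coords U i = R *v cell_coords U j + b + k"
      using orbit_inverse[OF inv j(2)] .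
    have "types U ! i = types U ! j"
      using j by (simp add: orbit_def)
    then have "x = (?L *v (R *v cell_coords U j + b + (k + l)), types U ! j)"
      using R(3) by (simp add: i(3) matrix_vector_right_distrib add.assoc flip: L)
    moreover have "k + l \<in> int_vectors"
      using R i by (simp add: int_vectors_add)
    ultimately show "x \<in> ?T"
      using R j by blast
  next
    fix x assume "x \<in> ?T"
    then obtain R b k j where R: "(R, b) \<in> symmetry_transformations U" "k \<in> int_vectors" "j \<in> I"
      "x = (?L *v (R *v cell_coords U j + b + k), types U ! j)"
      by blast
    have "j < num_atoms U"
      using irr R by (auto simp: irreducible_atom_set_def)
    then have "(?L *v cell_coords U j, types U ! j) \<in> ?S"
      unfolding infinite_structure_def L
      by (auto intro!: exI[of _ j] exI[of _ "0 :: real^3"])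
    then have "(?L *v (R *v cell_coords U j + b) + ?L *v k, types U ! j) \<in> ?S"
      using R by (intro infinite_structure_lattice_translate symmetry_transformation_mem)
        (auto simp: lattice_points_def)
    then show "x \<in> ?S"
      by (simp add: R(4) matrix_vector_right_distrib)
  qed
qed

section \<open>The structure read off from a sequence\<close>

text \<open>The basis is a parameter because \<open>lengths\<close> and \<open>angles\<close> fix it
  only up to a rotation. The integer vectors \<open>k\<close> restore what reduction modulo 1
  discards.\<close>

definition sequence_structure :: "mat2seq \<Rightarrow> real^3^3 \<Rightarrow> ((real^3) \<times> nat) set" where
  "sequence_structure X L =
     {(L *v (R *v vector [x, y, w] + b + k), z) | R b k z x y w.
        (R, b) \<in> set (symmetries X) \<and> k \<in> int_vectors \<and> (z, x, y, w) \<in> set (irreducible_atoms X)}"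

text \<open>The symmetries and atoms in the sequence are given in coordinates relative to the basis,
  so a linear map acts on the basis alone.\<close>

lemma move_sequence_structure:
  "move Q 0 ` sequence_structure X L = sequence_structure X (Q ** L)"
proof (intro set_eqI iffI)
  fix u assume "u \<in> move Q 0 ` sequence_structure X L"
  then show "u \<in> sequence_structure X (Q ** L)"
    by (fastforce simp: sequence_structure_def move_def matrix_vector_mul_assoc)
next
  fix u assume "u \<in> sequence_structure X (Q ** L)"
  then obtain R b k z x y w where u: "(R, b) \<in> set (symmetries X)" "k \<in> int_vectors"
    "(z, x, y, w) \<in> set (irreducible_atoms X)"
    "u = ((Q ** L) *v (R *v vector [x, y, w] + b + k), z)"
    unfolding sequence_structure_def by blast
  then have "u = move Q 0 (L *v (R *v vector [x, y, w] + b + k), z)"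
    by (simp add: move_def matrix_vector_mul_assoc)
  then show "u \<in> move Q 0 ` sequence_structure X L"
    using u(1-3) unfolding sequence_structure_def by blast
qed

section \<open>Rotations from lengths and angles\<close>

text \<open>For nonzero vectors Cauchy-Schwarz puts the quotient in the range where
  \<open>cos\<close> undoes \<open>arccos\<close>; a zero vector makes both sides 0.\<close>

lemma inner_vec_angle: "u \<bullet> v = norm u * norm v * cos (vec_angle u v)"
proof (cases "u = 0 \<or> v = 0")
  case False
  have "\<bar>(u \<bullet> v) / (norm u * norm v)\<bar> \<le> 1"
    using False Cauchy_Schwarz_ineq2[of u v] by (simp add: abs_mult)
  then show ?thesis
    using False by (simp add: vec_angle_def cos_arccos_abs)
qed auto

text \<open>The quotient \<open>L' ** matrix_inv L\<close> is orthogonal because the Gram matrices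
  agree, and the positive determinants exclude a reflection.\<close>

lemma rotation_of_equal_gram:
  fixes L L' :: "real^'n^'n"
  assumes det: "det L > 0" "det L' > 0"
    and gram: "\<And>i j. column i L \<bullet> column j L = column i L' \<bullet> column j L'"
  obtains Q where "rotation_matrix Q" "L' = Q ** L"
proof -
  have inv: "invertible L"
    using det by (simp add: invertible_det_nz)
  have LL: "transpose L ** L = transpose L' ** L'"
    using gram by (simp add: vec_eq_iff matrix_mult_transpose_dot_column)
  define Q where "Q = L' ** matrix_inv L"
  have QL: "L' = Q ** L"
    by (simp add: Q_def matrix_inv_left[OF inv] flip: matrix_mul_assoc)
  have "transpose Q ** Q
      = transpose (matrix_inv L) ** (transpose L ** L) ** matrix_inv L"
    by (simp add: Q_def matrix_transpose_mul LL matrix_mul_assoc)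
  also have "\<dots> = transpose (L ** matrix_inv L) ** (L ** matrix_inv L)"
    by (simp add: matrix_transpose_mul matrix_mul_assoc)
  finally have orth: "orthogonal_matrix Q"
    by (simp add: orthogonal_matrix matrix_inv_right[OF inv])
  have "det Q * det L > 0"
    using det by (simp add: QL det_mul)
  then have "det Q > 0"
    using det by (simp add: zero_less_mult_iff)
  then have "det Q = 1"
    using det_orthogonal_matrix[OF orth] by auto
  then show thesis
    using orth QL that by (simp add: rotation_matrix_def)
qed

section \<open>Uniqueness and recovery\<close>

text \<open>Here \<open>L\<close> is the basis chosen in the construction and \<open>t\<close> moves
  the origin atom to 0.\<close>

lemma is_mat2seq_structure:
  assumes "unit_cell M" "is_mat2seq r \<sigma> ord M X"
  obtains L t where "det L > 0"
    "sequence_structure X L = move (mat 1) t ` infinite_structure M"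
    "lengths X = (norm (column 1 L), norm (column 2 L), norm (column 3 L))"
    "angles X = (vec_angle (column 2 L) (column 3 L), vec_angle (column 1 L) (column 3 L),
       vec_angle (column 1 L) (column 2 L))"
proof -
  obtain L i U js where nig: "niggli_basis (lattice M) L" and U: "U = shifted_cell L M i"
    and js: "irreducible_listing ord U js" and syms: "set (symmetries X) = symmetry_transformations U"
    and len: "lengths X = (norm (column 1 L), norm (column 2 L), norm (column 3 L))"
    and ang: "angles X = (vec_angle (column 2 L) (column 3 L), vec_angle (column 1 L) (column 3 L),
       vec_angle (column 1 L) (column 2 L))"
    and atoms: "irreducible_atoms X =
      map (\<lambda>j. (types U ! j, cell_coords U j $ 1, cell_coords U j $ 2, cell_coords U j $ 3)) js"
    using assms(2) unfolding is_mat2seq_def by blast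
  have det: "det L > 0" and lat: "lattice_points L = lattice_points (lattice M)"
    using nig by (auto simp: niggli_basis_def)
  have inv: "invertible L"
    using det by (simp add: invertible_det_nz)
  have LU: "lattice U = L"
    by (simp add: U shifted_cell_def)
  \<comment> \<open>Reassembles the coordinate triples listed in \<open>X\<close> into
    vectors.\<close>
  have vec: "vector [q $ 1, q $ 2, q $ 3] = q" for q :: "real^3"
    by (simp add: vec_eq_iff forall_3)
  have "irreducible_atom_set U (set js)"
    using js by (simp add: irreducible_listing_def)
  then have "infinite_structure U =
    {(L *v (R *v cell_coords U j + b + k), types U ! j) | R b k j.
       (R, b) \<in> symmetry_transformations U \<and> k \<in> int_vectors \<and> j \<in> set js}"
    using infinite_structure_from_irreducible[of U "set js"] inv LU by simp
  also have "\<dots> = sequence_structure X L"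
    unfolding sequence_structure_def syms atoms set_map image_iff
    by (auto simp: vec) (metis vec)+
  finally have "sequence_structure X L = move (mat 1) (- (positions M ! i)) ` infinite_structure M"
    using infinite_structure_shifted_cell[OF assms(1) inv lat, of i] by (simp add: U)
  with det show thesis
    using len ang by (rule that)
qed

text \<open>Up to translation, both structures are the same sequence read with two bases, and these
  bases have equal lengths and angles.\<close>

lemma is_mat2seq_unique:
  assumes "unit_cell M" "is_mat2seq r \<sigma> ord M X" "unit_cell M'" "is_mat2seq r \<sigma> ord M' X"
  shows "\<exists>R b. rotation_matrix R \<and> infinite_structure M' = move R b ` infinite_structure M"
proof -
  obtain L t where L: "det L > 0"
    "sequence_structure X L = move (mat 1) t ` infinite_structure M"
    "lengths X = (norm (column 1 L), norm (column 2 L), norm (column 3 L))"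
    "angles X = (vec_angle (column 2 L) (column 3 L), vec_angle (column 1 L) (column 3 L),
       vec_angle (column 1 L) (column 2 L))"
    using is_mat2seq_structure[OF assms(1,2)] .
  obtain L' t' where L': "det L' > 0"
    "sequence_structure X L' = move (mat 1) t' ` infinite_structure M'"
    "lengths X = (norm (column 1 L'), norm (column 2 L'), norm (column 3 L'))"
    "angles X = (vec_angle (column 2 L') (column 3 L'), vec_angle (column 1 L') (column 3 L'),
       vec_angle (column 1 L') (column 2 L'))"
    using is_mat2seq_structure[OF assms(3,4)] .
  have norms: "norm (column i L) = norm (column i L')" for i
    using L(3) L'(3) exhaust_3[of i] by auto
  \<comment> \<open>Three unordered pairs are recorded; symmetry of the angle supplies the other
    ordered ones.\<close>
  have "vec_angle (column i L) (column j L) = vec_angle (column i L') (column j L')"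
    if "i \<noteq> j" for i j
    using L(4) L'(4) exhaust_3[of i] exhaust_3[of j] that
    by (auto simp: vec_angle_def inner_commute mult.commute)
  then have "column i L \<bullet> column j L = column i L' \<bullet> column j L'" for i j
    using norms by (cases "i = j") (simp_all add: dot_square_norm inner_vec_angle[of "column i _"])
  with L(1) L'(1) obtain Q where Q: "rotation_matrix Q" "L' = Q ** L"
    by (rule rotation_of_equal_gram)
  \<comment> \<open>Undo the translation by \<open>t'\<close>, replace \<open>L'\<close> by
    \<open>Q ** L\<close>, then pull \<open>Q\<close> out to reach the structure of
    \<open>M\<close>.\<close>
  have "infinite_structure M' = move (mat 1) (- t') ` sequence_structure X L'"
    by (simp add: L'(2) image_image move_move)
  also have "\<dots> = move (mat 1) (- t') ` move Q 0 ` move (mat 1) t ` infinite_structure M"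
    by (simp only: Q(2) L(2) flip: move_sequence_structure)
  also have "\<dots> = move Q (Q *v t + - t') ` infinite_structure M"
    by (simp add: image_image move_move)
  finally show ?thesis
    using Q(1) by blast
qed

theorem lemma3:
  fixes r :: real and \<sigma> :: "nat \<Rightarrow> int" and ord :: "atom_key rel"
  assumes "r > 0"
    and "\<forall>m. \<sigma> m = 1 \<or> \<sigma> m = -1"
    and "linear_order ord"
  shows "\<exists>recover :: mat2seq \<Rightarrow> crystal. \<forall>M X.
           primitive_cell M \<and> is_mat2seq r \<sigma> ord M X \<longrightarrow>
             unit_cell (recover X) \<and>
             (\<exists>R b. rotation_matrix R \<and>
                infinite_structure (recover X) = move R b ` infinite_structure M)"
proof (intro exI allI impI)
  fix M X
  let ?P = "\<lambda>X N. primitive_cell N \<and> is_mat2seq r \<sigma> ord N X"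
  \<comment> \<open>The value is arbitrary where no primitive cell has the sequence
    \<open>X\<close>; below, \<open>M\<close> is such a cell, so the choice satisfies its condition
    and uniqueness compares it with \<open>M\<close>.\<close>
  let ?recover = "\<lambda>X. SOME N. ?P X N"
  assume M: "?P X M"
  then have N: "?P X (?recover X)"
    by (rule someI)
  show "unit_cell (?recover X) \<and>
      (\<exists>R b. rotation_matrix R \<and>
         infinite_structure (?recover X) = move R b ` infinite_structure M)"
    using M N is_mat2seq_unique unfolding primitive_cell_def by blast
qed

end
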